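(* Let $S$ be a semigroup, let $F$ be a field with $\mathrm{char}(F)\neq 2$, let $\sigma:S\to S$ be an involutive anti-automorphism, and let $\beta\in F\setminus\{0\}$ and $\gamma\in F$. Suppose $f,g:S\to F$ are linearly independent and satisfy \[ f(x\sigma(y))=f(x)g(y)+\beta\,g(x)f(y)+\gamma\,f(x)f(y)\qquad\text{for all }x,y\in S. \] Assume that there exists $d\in S$ such that \[ f(d)\neq0\qquad\text{and}\qquad L(d)f\in \mathrm{span}\{f,g\}. \] Then the following hold. (i) If $\beta=-1$, then $\gamma=0$. Furthermore, there exists $a\in F$ such that \[ f(xy)=f(x)g(y)+g(x)f(y)+a\,f(x)f(y)\qquad\text{for all }x,y\in S, \] and \[ f\circ\sigma=-f,\qquad g\circ\sigma=g+af. \] (ii) If $\beta\neq -1$, then necessarily $\beta=1$, and \[ f(xy)=f(x)g(y)+g(x)f(y)+\gamma\,f(x)f(y)\qquad\text{for all }x,y\in S, \] and \[ f\circ\sigma=f,\qquad g\circ\sigma=g. \]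
   Context: An involutive anti-automorphism of $S$ is a bijective map $\sigma:S\to S$ with $\sigma(xy)=\sigma(y)\sigma(x)$ for all $x,y\in S$ and $\sigma^2=\mathrm{id}$. For $d\in S$ and $h:S\to F$, the function $L(d)h:S\to F$ is defined by $(L(d)h)(x):=h(dx)$. Spans and linear independence are over $F$ in the vector space of all functions $S\to F$. *)

theory Defs
  imports Complex_Main "HOL-Library.Function_Algebras"
begin

definition involutive_anti_automorphism :: "('s::semigroup_mult \<Rightarrow> 's) \<Rightarrow> bool" where
  "involutive_anti_automorphism \<sigma> \<longleftrightarrow>
     bij \<sigma> \<and> (\<forall>x y. \<sigma> (x * y) = \<sigma> y * \<sigma> x) \<and> \<sigma> \<circ> \<sigma> = id"

definition left_translate :: "'s::semigroup_mult \<Rightarrow> ('s \<Rightarrow> 'f) \<Rightarrow> 's \<Rightarrow> 'f" where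
  "left_translate d h = (\<lambda>x. h (d * x))"

definition fun_scale :: "'f::field \<Rightarrow> ('s \<Rightarrow> 'f) \<Rightarrow> 's \<Rightarrow> 'f" where
  "fun_scale c h = (\<lambda>x. c * h x)"

global_interpretation fun_space: vector_space "fun_scale :: 'f::field \<Rightarrow> ('s \<Rightarrow> 'f) \<Rightarrow> 's \<Rightarrow> 'f"
  by unfold_locales (auto simp: fun_scale_def algebra_simps)

(* The set {f, g} collapses to a singleton when f = g, so linear independence of the
   pair f, g (as a family) also needs f and g to be distinct. *)
definition lin_indep_pair :: "('s \<Rightarrow> 'f::field) \<Rightarrow> ('s \<Rightarrow> 'f) \<Rightarrow> bool" where
  "lin_indep_pair f g \<longleftrightarrow> f \<noteq> g \<and> fun_space.independent {f, g}"

end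

theory Submission
  imports Defs
begin

text \<open>
  Rewrite the equation as \<open>f(xy) = f(x) A(y) + \<beta> g(x) f(\<sigma>(y))\<close> and expand \<open>f(xyz)\<close> in two ways.
  Since \<open>f\<close> and \<open>g\<close> are independent, this gives \<open>g(xy) = f(x) P(y) + g(x) Q(y)\<close> and a second
  formula for \<open>f(\<sigma>(yz))\<close>; comparing it with the original equation forces \<open>f \<circ> \<sigma> = \<beta> f\<close>, hence
  \<open>\<beta>\<^sup>2 = 1\<close>, and \<open>Q = g\<close>. The hypothesis on \<open>d\<close> now says \<open>g \<circ> \<sigma> = \<kappa> f + \<mu> g\<close>. As \<open>\<sigma>\<close> is an
  involution, \<open>\<mu>\<^sup>2 = 1\<close> and \<open>\<kappa>(\<beta> + \<mu>) = 0\<close>; comparing the coefficients of \<open>g(x) g(y)\<close> in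
  \<open>g(\<sigma>(xy)) = g(\<sigma>(y) \<sigma>(x))\<close> gives \<open>\<mu> = \<mu>\<^sup>2\<close>, so \<open>\<mu> = 1\<close>.
\<close>

text \<open>If all these determinants vanished, a point \<open>u\<close> with
  \<open>f u \<noteq> 0\<close> would make \<open>g\<close> the multiple \<open>g u / f u\<close> of
  \<open>f\<close>. One nonzero determinant turns later coefficient comparisons into Cramer's
  rule.\<close>

lemma lin_indep_pair_det:
  assumes "lin_indep_pair f g"
  obtains u v where "f u * g v - f v * g u \<noteq> 0"
proof -
  have fg: "f \<noteq> g" "fun_space.independent {g, f}"
    using assms by (simp_all add: lin_indep_pair_def insert_commute)
  hence g: "g \<notin> fun_space.span {f}" and "fun_space.independent {f}"
    by (auto simp: fun_space.independent_insert split: if_splits)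
  hence "f \<noteq> 0"
    using fun_space.dependent_zero by blast
  then obtain u where u: "f u \<noteq> 0"
    by (auto simp: fun_eq_iff)
  have "\<exists>v. f u * g v - f v * g u \<noteq> 0"
  proof (rule ccontr)
    assume "\<not> ?thesis"
    hence "g = fun_scale (g u / f u) f"
      using u by (auto simp: fun_scale_def fun_eq_iff field_simps)
    hence "g \<in> fun_space.span {f}"
      using fun_space.span_base fun_space.span_scale by (metis singletonI)
    with g show False ..
  qed
  with that show thesis by blast
qed

lemma det_indep:
  fixes f g :: "'s \<Rightarrow> 'f::field"
  assumes "f u * g v - f v * g u \<noteq> 0" and "\<And>x. a * f x + b * g x = 0"
  shows "a = 0" "b = 0"
proof -
  have "a * (f u * g v - f v * g u) = (a * f u + b * g u) * g v - (a * f v + b * g v) * g u"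
    "b * (f u * g v - f v * g u) = (a * f v + b * g v) * f u - (a * f u + b * g u) * f v"
    by (simp_all add: algebra_simps)
  thus "a = 0" "b = 0"
    using assms by simp_all
qed

text \<open>Eliminating \<open>R y\<close> between \<open>x = u\<close> and \<open>x = v\<close>
  leaves a linear relation between \<open>f\<close> and \<open>g\<close> whose coefficient at
  \<open>g\<close> is \<open>k\<close> times the determinant.\<close>

lemma det_no_square_term:
  fixes f g :: "'s \<Rightarrow> 'f::field"
  assumes det: "f u * g v - f v * g u \<noteq> 0"
    and eq: "\<And>x y. k * g x * g y = f x * R y + f y * T x"
  shows "k = 0"
proof -
  define D where "D = f u * g v - f v * g u"
  have "(f v * T u - f u * T v) * f y + (k * D) * g y = 0" for y
    using eq[of v y] eq[of u y] unfolding D_def by algebra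
  hence "k * D = 0"
    using det_indep(2)[OF det] by blast
  thus ?thesis using det D_def by simp
qed

text \<open>The two expansions of \<open>f (x * y * z)\<close> isolate
  \<open>g (x * y) * B z\<close>; dividing by \<open>B w\<close> at \<open>z = w\<close> yields
  \<open>P\<close> and \<open>Q\<close>. Substituting back for general \<open>z\<close> and
  comparing coefficients of \<open>g x\<close> gives the law for \<open>B\<close>.\<close>

lemma addition_law_associativity:
  fixes f g A B :: "'s::semigroup_mult \<Rightarrow> 'f::field"
  assumes det: "f u * g v - f v * g u \<noteq> 0"
    and law: "\<And>x y. f (x * y) = f x * A y + g x * B y"
    and w: "B w \<noteq> 0"
  obtains P Q where "\<And>x y. g (x * y) = f x * P y + g x * Q y"
    and "\<And>y z. B (y * z) = B y * A z + Q y * B z"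
proof -
  have assoc: "f x * (A (y * z) - A y * A z) + g x * (B (y * z) - B y * A z) = g (x * y) * B z"
    for x y z
    using law[of "x * y" z] law[of x "y * z"] law[of x y]
    by (simp add: mult.assoc[of x y z] algebra_simps)
  define P where "P = (\<lambda>y. (A (y * w) - A y * A w) / B w)"
  define Q where "Q = (\<lambda>y. (B (y * w) - B y * A w) / B w)"
  have g: "g (x * y) = f x * P y + g x * Q y" for x y
  proof -
    have "g (x * y) = (f x * (A (y * w) - A y * A w) + g x * (B (y * w) - B y * A w)) / B w"
      using w by (simp add: assoc)
    thus ?thesis
      unfolding P_def Q_def by (simp add: add_divide_distrib)
  qed
  have "B (y * z) = B y * A z + Q y * B z" for y z
  proof -
    have "(A (y * z) - A y * A z - P y * B z) * f x
        + (B (y * z) - B y * A z - Q y * B z) * g x = 0" for x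
      using assoc[of x y z] g[of x y] by (simp add: algebra_simps)
    from det_indep(2)[OF det this] show ?thesis by (simp add: algebra_simps)
  qed
  with g that show thesis by blast
qed

theorem theorem4p6:
  fixes \<sigma> :: "'s::semigroup_mult \<Rightarrow> 's"
    and f g :: "'s \<Rightarrow> 'f::field"
    and \<beta> \<gamma> :: 'f
  assumes "CHAR('f) \<noteq> 2"
    and "involutive_anti_automorphism \<sigma>"
    and "\<beta> \<noteq> 0"
    and "lin_indep_pair f g"
    and "\<forall>x y. f (x * \<sigma> y) = f x * g y + \<beta> * g x * f y + \<gamma> * f x * f y"
    and "\<exists>d. f d \<noteq> 0 \<and> left_translate d f \<in> fun_space.span {f, g}"
  shows "(\<beta> = -1 \<longrightarrow>
           \<gamma> = 0 \<and>
           (\<exists>a. (\<forall>x y. f (x * y) = f x * g y + g x * f y + a * f x * f y) \<and>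
                f \<circ> \<sigma> = - f \<and> g \<circ> \<sigma> = g + fun_scale a f)) \<and>
         (\<beta> \<noteq> -1 \<longrightarrow>
           \<beta> = 1 \<and>
           (\<forall>x y. f (x * y) = f x * g y + g x * f y + \<gamma> * f x * f y) \<and>
           f \<circ> \<sigma> = f \<and> g \<circ> \<sigma> = g)"
proof -
  have invol: "\<sigma> (\<sigma> x) = x" and anti: "\<sigma> (x * y) = \<sigma> y * \<sigma> x" for x y
    using assms(2) by (auto simp: involutive_anti_automorphism_def fun_eq_iff)
  have eq: "f (x * \<sigma> y) = f x * g y + \<beta> * g x * f y + \<gamma> * f x * f y" for x y
    using assms(5) by blast
  obtain u v where det: "f u * g v - f v * g u \<noteq> 0"
    using lin_indep_pair_det[OF assms(4)] .
  obtain d where d: "f d \<noteq> 0" "left_translate d f \<in> fun_space.span {f, g}"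
    using assms(6) by blast
  from d(2) obtain a b where ab: "\<And>x. f (d * x) = a * f x + b * g x"
  proof -
    from d(2) obtain a b where "left_translate d f - fun_scale a f = fun_scale b g"
      by (auto simp: fun_space.span_insert fun_space.span_singleton)
    hence "f (d * x) = a * f x + b * g x" for x
      by (auto simp: left_translate_def fun_scale_def fun_eq_iff algebra_simps)
    with that show thesis by blast
  qed

  have law: "f (x * y) = f x * (g (\<sigma> y) + \<gamma> * f (\<sigma> y)) + g x * (\<beta> * f (\<sigma> y))" for x y
    using eq[of x "\<sigma> y"] by (simp add: invol algebra_simps)
  have "\<beta> * f (\<sigma> (\<sigma> d)) \<noteq> 0"
    using assms(3) d(1) by (simp add: invol)
  then obtain P Q where P: "\<And>x y. g (x * y) = f x * P y + g x * Q y"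
    and Q: "\<And>y z. \<beta> * f (\<sigma> (y * z))
      = \<beta> * f (\<sigma> y) * (g (\<sigma> z) + \<gamma> * f (\<sigma> z)) + Q y * (\<beta> * f (\<sigma> z))"
    using addition_law_associativity[OF det law, where w = "\<sigma> d"] by blast
  \<comment> \<open>Since \<open>\<sigma> (y * \<sigma> z) = z * \<sigma> y\<close>, the law for
    \<open>Q\<close> and the original equation both expand \<open>f (z * \<sigma> y)\<close>; cancel
    \<beta> and compare as functions of \<open>z\<close>.\<close>
  have coeffs: "g y + \<gamma> * f y - \<gamma> * f (\<sigma> y) - Q y = 0" "\<beta> * f y - f (\<sigma> y) = 0" for y
  proof -
    have "(g y + \<gamma> * f y - \<gamma> * f (\<sigma> y) - Q y) * f z + (\<beta> * f y - f (\<sigma> y)) * g z = 0" for z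
    proof -
      have "\<beta> * ((g y + \<gamma> * f y - \<gamma> * f (\<sigma> y) - Q y) * f z + (\<beta> * f y - f (\<sigma> y)) * g z) = 0"
        using Q[of y "\<sigma> z"] eq[of z y] by (simp add: anti invol algebra_simps)
      with assms(3) show ?thesis by simp
    qed
    from det_indep[OF det this]
    show "g y + \<gamma> * f y - \<gamma> * f (\<sigma> y) - Q y = 0" "\<beta> * f y - f (\<sigma> y) = 0" .
  qed
  have f\<sigma>: "f (\<sigma> y) = \<beta> * f y" for y
    using coeffs(2)[of y] by simp
  have "\<beta> * \<beta> = 1"
    using f\<sigma>[of "\<sigma> d"] f\<sigma>[of d] d(1) by (simp add: invol flip: mult.assoc)
  hence \<beta>\<beta>: "\<beta> * (\<beta> * x) = x" for x
    by (simp flip: mult.assoc)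
  from \<open>\<beta> * \<beta> = 1\<close> have \<beta>: "\<beta> = 1 \<or> \<beta> = - 1"
    by (simp add: square_eq_1_iff)

  \<comment> \<open>Both constants come from equating \<open>law\<close> at \<open>x = d\<close>
    with \<open>ab\<close> and solving for \<open>g (\<sigma> x)\<close>.\<close>
  define \<kappa> where "\<kappa> = (a - \<gamma> * \<beta> * f d - g d) / f d"
  define \<mu> where "\<mu> = b / f d"
  have g\<sigma>: "g (\<sigma> x) = \<kappa> * f x + \<mu> * g x" for x
  proof -
    have "f d * g (\<sigma> x) = (a - \<gamma> * \<beta> * f d - g d) * f x + b * g x"
      using law[of d x] ab[of x] by (simp add: f\<sigma> \<beta>\<beta> algebra_simps)
    thus ?thesis
      using d(1) by (simp add: \<kappa>_def \<mu>_def field_simps)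
  qed
  have "(\<kappa> * (\<beta> + \<mu>)) * f x + (\<mu> * \<mu> - 1) * g x = 0" for x
    using g\<sigma>[of "\<sigma> x"] by (simp add: invol f\<sigma> g\<sigma> algebra_simps)
  from det_indep[OF det this] have \<kappa>\<mu>: "\<kappa> * (\<beta> + \<mu>) = 0" "\<mu> * \<mu> = 1"
    by simp_all
  have f_mult: "f (x * y) = f x * (g (\<sigma> y) + \<gamma> * \<beta> * f y) + g x * f y" for x y
    using law[of x y] by (simp add: f\<sigma> \<beta>\<beta> algebra_simps)
  \<comment> \<open>The term with \<open>\<gamma> * (1 - \<beta>)\<close> is carried along: for
    \<beta> = -1 it disappears only once \<gamma> = 0 is known.\<close>
  have g_mult: "g (x * y) = f x * P y + g x * (g y + \<gamma> * (1 - \<beta>) * f y)" for x y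
    using P[of x y] coeffs(1)[of y] by (simp add: f\<sigma> algebra_simps)
  have "\<exists>R T. \<forall>x y. (\<mu> - \<mu> * \<mu>) * g x * g y = f x * R y + f y * T x"
  proof (intro exI allI)
    fix x y
    \<comment> \<open>Expanding both sides, every term except those in \<open>g x * g y\<close> has
      a factor \<open>f x\<close> or \<open>f y\<close>; collecting them gives the witnesses
      \<open>R\<close> and \<open>T\<close>.\<close>
    have "\<kappa> * f (x * y) + \<mu> * g (x * y) = g (\<sigma> y * \<sigma> x)"
      using g\<sigma>[of "x * y"] by (simp add: anti)
    thus "(\<mu> - \<mu> * \<mu>) * g x * g y = f x * (\<kappa> * \<kappa> * f y + \<kappa> * \<mu> * g y
        - \<kappa> * (g (\<sigma> y) + \<gamma> * \<beta> * f y) - \<mu> * P y + \<gamma> * (1 - \<beta>) * \<beta> * g (\<sigma> y))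
      + f y * (\<beta> * P (\<sigma> x) + \<kappa> * \<mu> * g x - \<kappa> * g x - \<mu> * \<gamma> * (1 - \<beta>) * g x)"
      unfolding f_mult g_mult by (simp add: f\<sigma> g\<sigma> algebra_simps)
  qed
  then have "\<mu> - \<mu> * \<mu> = 0"
    using det_no_square_term[OF det] by blast
  with \<kappa>\<mu> have "\<mu> = 1" and \<kappa>: "\<kappa> * (\<beta> + 1) = 0"
    by auto
  have g\<sigma>': "g (\<sigma> x) = g x + \<kappa> * f x" for x
    using g\<sigma>[of x] \<open>\<mu> = 1\<close> by simp

  show ?thesis
  proof (intro conjI impI)
    assume [simp]: "\<beta> = - 1"
    have two: "(2::'f) \<noteq> 0"
    proof
      assume "(2::'f) = 0"
      hence "CHAR('f) dvd 2"
        using of_nat_eq_0_iff_char_dvd[where 'a = 'f, of 2] by simp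
      hence "CHAR('f) \<le> 2" "CHAR('f) \<noteq> 0"
        by (auto dest: dvd_imp_le intro!: Nat.gr0I)
      with assms(1) have "CHAR('f) = 1" by linarith
      thus False
        using of_nat_CHAR[where 'a = 'f] by simp
    qed
    \<comment> \<open>The element \<open>d * \<sigma> d\<close> is fixed by \<sigma>, while
      \<open>f\<close> changes sign under \<sigma>. For \<beta> = -1 the mixed terms cancel, so
      \<open>f (d * \<sigma> d)\<close> is \<open>\<gamma> * f d * f d\<close>.\<close>
    have "f (d * \<sigma> d) = - f (d * \<sigma> d)"
      using f\<sigma>[of "d * \<sigma> d"] by (simp add: anti invol)
    hence "2 * (\<gamma> * f d * f d) = 0"
      unfolding eq by (simp add: algebra_simps)
    with two d(1) show "\<gamma> = 0" by simp
    show "\<exists>a. (\<forall>x y. f (x * y) = f x * g y + g x * f y + a * f x * f y) \<and>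
        f \<circ> \<sigma> = - f \<and> g \<circ> \<sigma> = g + fun_scale a f"
      \<comment> \<open>The witness is \<kappa>: replacing \<open>g (\<sigma> y)\<close> in
        \<open>f_mult\<close> by \<open>g y + \<kappa> * f y\<close> produces the term
        \<open>a * f x * f y\<close>.\<close>
      using f_mult f\<sigma> g\<sigma>' \<open>\<gamma> = 0\<close>
      by (intro exI[of _ \<kappa>]) (auto simp: fun_eq_iff fun_scale_def algebra_simps)
  next
    assume "\<beta> \<noteq> - 1"
    with \<beta> show [simp]: "\<beta> = 1" by blast
    from \<kappa> \<open>\<beta> \<noteq> - 1\<close> have [simp]: "\<kappa> = 0"
      by (metis add_eq_0_iff2 mult_eq_0_iff)
    show "\<forall>x y. f (x * y) = f x * g y + g x * f y + \<gamma> * f x * f y"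
      using f_mult g\<sigma>' by (simp add: algebra_simps)
    show "f \<circ> \<sigma> = f" "g \<circ> \<sigma> = g"
      using f\<sigma> g\<sigma>' by (simp_all add: fun_eq_iff)
  qed
qed

end
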